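(* Let $\mathcal{L}=(L,\vee,\wedge,\otimes,\rightarrow,0,1)$ be a residuated lattice satisfying the double negation law. Then $\mathbf{L}(\mathbf{C}(\mathcal{L}))=\mathcal{L}$.
   Context: A residuated lattice is an algebra $\mathcal{L}=(L,\vee,\wedge,\otimes,\rightarrow,0,1)$ of type $(2,2,2,2,0,0)$ such that for all $x,y,z\in L$: (i) $(L,\vee,\wedge,0,1)$ is a bounded lattice (with least element $0$, greatest element $1$ and induced order $\leq$); (ii) $(L,\otimes,1)$ is a commutative monoid; (iii) $x\leq y\rightarrow z$ if and only if $x\otimes y\leq z$. In a residuated lattice put $\neg x:=x\rightarrow 0$ and $x\oplus y:=\neg(\neg x\otimes\neg y)$. The residuated lattice satisfies the double negation law if $\neg\neg x=x$ for all $x\in L$. A commutative semiring is an algebra $(S,+,\cdot,0,1)$ of type $(2,2,0,0)$ such that for all $x,y,z\in S$: (i) $(S,+,0)$ and $(S,\cdot,1)$ are commutative monoids; (ii) $x(y+z)=xy+xz$; (iii) $x0=0$. In $(A,\wedge,\ast,1,0)$ the addition is $\wedge$ with neutral element $1$, and the multiplication is $\ast$ with neutral element $0$. Homomorphisms and isomorphisms of semirings preserve both operations and both constants, in the listed order. A general coupled semiring is an ordered triple $((A,\vee,\cdot,0,1),(A,\wedge,\ast,1,0),\alpha)$ such that for all $x,y\in A$: (i) $(A,\vee,\cdot,0,1)$ and $(A,\wedge,\ast,1,0)$ are commutative semirings; (ii) $(A,\vee,\wedge)$ is a lattice (with induced order $\leq$); (iii) $\alpha$ is an isomorphism from $(A,\vee,\cdot,0,1)$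 to $(A,\wedge,\ast,1,0)$; (iv) $\alpha(\alpha(x))=x$; (v) $x\leq y$ if and only if $\alpha(x)\ast y=1$. For a residuated lattice $\mathcal{L}=(L,\vee,\wedge,\otimes,\rightarrow,0,1)$ satisfying the double negation law, $\mathbf{C}(\mathcal{L}):=((L,\vee,\otimes,0,1),(L,\wedge,\oplus,1,0),\neg)$, which is a general coupled semiring. For a general coupled semiring $\mathcal{C}=((A,\vee,\cdot,0,1),(A,\wedge,\ast,1,0),\alpha)$, $\mathbf{L}(\mathcal{C}):=(A,\vee,\wedge,\cdot,\rightarrow,0,1)$ where $x\rightarrow y:=\alpha(x)\ast y$ for all $x,y\in A$; it is a residuated lattice satisfying the double negation law. *)

theory Defs
  imports "HOL-Algebra.QuotRing"
begin

text \<open>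
  Algebras are records with an explicit carrier, and every operation of an algebra with carrier
  \<open>A\<close> is required to be \<open>undefined\<close> outside \<open>A\<close>. Operations are thereby genuine functions on
  \<open>A\<close>, and two algebras are equal as records iff they have the same carrier, the same
  operations on it and the same constants.
\<close>

definition binary_op :: "'a set \<Rightarrow> ('a \<Rightarrow> 'a \<Rightarrow> 'a) \<Rightarrow> bool"
  where "binary_op A f \<longleftrightarrow> f \<in> A \<rightarrow>\<^sub>E A \<rightarrow>\<^sub>E A"

definition lattice_ops :: "'a set \<Rightarrow> ('a \<Rightarrow> 'a \<Rightarrow> 'a) \<Rightarrow> ('a \<Rightarrow> 'a \<Rightarrow> 'a) \<Rightarrow> bool"
  where "lattice_ops A j m \<longleftrightarrow>
    binary_op A j \<and> binary_op A m \<and>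
    (\<forall>x\<in>A. \<forall>y\<in>A. j x y = j y x \<and> m x y = m y x) \<and>
    (\<forall>x\<in>A. \<forall>y\<in>A. \<forall>z\<in>A. j (j x y) z = j x (j y z) \<and> m (m x y) z = m x (m y z)) \<and>
    (\<forall>x\<in>A. \<forall>y\<in>A. j x (m x y) = x \<and> m x (j x y) = x)"

definition induced_le :: "('a \<Rightarrow> 'a \<Rightarrow> 'a) \<Rightarrow> 'a \<Rightarrow> 'a \<Rightarrow> bool"
  where "induced_le j x y \<longleftrightarrow> j x y = y"


text \<open>The monoid part of the record carries \<open>\<otimes>\<close> and the greatest element \<open>1\<close>.\<close>

record 'a residuated = "'a monoid" +
  rjoin :: "'a \<Rightarrow> 'a \<Rightarrow> 'a" (infixl \<open>\<curlyvee>\<index>\<close> 65)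
  rmeet :: "'a \<Rightarrow> 'a \<Rightarrow> 'a" (infixl \<open>\<curlywedge>\<index>\<close> 67)
  rimp  :: "'a \<Rightarrow> 'a \<Rightarrow> 'a" (infixr \<open>\<leadsto>\<index>\<close> 60)
  rzero :: "'a"

abbreviation rle :: "('a, 'b) residuated_scheme \<Rightarrow> 'a \<Rightarrow> 'a \<Rightarrow> bool" (infix \<open>\<preceq>\<index>\<close> 50)
  where "x \<preceq>\<^bsub>L\<^esub> y \<equiv> induced_le (rjoin L) x y"

locale residuated_lattice = comm_monoid L for L (structure) +
  assumes mult_op: "binary_op (carrier L) (mult L)"
    and imp_op: "binary_op (carrier L) (rimp L)"
    and lattice: "lattice_ops (carrier L) (rjoin L) (rmeet L)"
    and zero_closed: "rzero L \<in> carrier L"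
    and zero_least: "x \<in> carrier L \<Longrightarrow> rzero L \<preceq> x"
    and one_greatest: "x \<in> carrier L \<Longrightarrow> x \<preceq> \<one>"
    and adjoint: "\<lbrakk>x \<in> carrier L; y \<in> carrier L; z \<in> carrier L\<rbrakk>
      \<Longrightarrow> x \<preceq> y \<leadsto> z \<longleftrightarrow> x \<otimes> y \<preceq> z"

definition rneg :: "('a, 'b) residuated_scheme \<Rightarrow> 'a \<Rightarrow> 'a"
  where "rneg L = (\<lambda>x\<in>carrier L. x \<leadsto>\<^bsub>L\<^esub> rzero L)"

definition rplus :: "('a, 'b) residuated_scheme \<Rightarrow> 'a \<Rightarrow> 'a \<Rightarrow> 'a"
  where "rplus L = (\<lambda>x\<in>carrier L. \<lambda>y\<in>carrier L. rneg L (rneg L x \<otimes>\<^bsub>L\<^esub> rneg L y))"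

definition double_negation_law :: "('a, 'b) residuated_scheme \<Rightarrow> bool"
  where "double_negation_law L \<longleftrightarrow> (\<forall>x\<in>carrier L. rneg L (rneg L x) = x)"


definition commutative_semiring :: "('a, 'b) ring_scheme \<Rightarrow> bool"
  where "commutative_semiring R \<longleftrightarrow>
    semiring R \<and> comm_monoid R \<and>
    binary_op (carrier R) (add R) \<and> binary_op (carrier R) (mult R)"

text \<open>A \<open>ring_hom\<close> need not preserve \<open>0\<close> when its domain is only a semiring.\<close>

definition semiring_iso :: "('a, 'c) ring_scheme \<Rightarrow> ('b, 'd) ring_scheme \<Rightarrow> ('a \<Rightarrow> 'b) set"
  where "semiring_iso R S = {h \<in> ring_iso R S. h \<zero>\<^bsub>R\<^esub> = \<zero>\<^bsub>S\<^esub>}"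

type_synonym 'a coupled = "'a ring \<times> 'a ring \<times> ('a \<Rightarrow> 'a)"

text \<open>
  In \<open>(S, T, \<alpha>)\<close>, addition of \<open>S\<close> is \<open>\<or>\<close>, addition of \<open>T\<close> is \<open>\<and>\<close>, and the two constants of \<open>S\<close>
  are those of \<open>T\<close> in the opposite roles.
\<close>

fun general_coupled_semiring :: "'a coupled \<Rightarrow> bool"
  where "general_coupled_semiring (S, T, \<alpha>) \<longleftrightarrow>
    carrier T = carrier S \<and> \<zero>\<^bsub>T\<^esub> = \<one>\<^bsub>S\<^esub> \<and> \<one>\<^bsub>T\<^esub> = \<zero>\<^bsub>S\<^esub> \<and>
    commutative_semiring S \<and> commutative_semiring T \<and>
    lattice_ops (carrier S) (add S) (add T) \<and>
    \<alpha> \<in> extensional (carrier S) \<and> \<alpha> \<in> semiring_iso S T \<and>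
    (\<forall>x\<in>carrier S. \<alpha> (\<alpha> x) = x) \<and>
    (\<forall>x\<in>carrier S. \<forall>y\<in>carrier S.
      induced_le (add S) x y \<longleftrightarrow> \<alpha> x \<otimes>\<^bsub>T\<^esub> y = \<one>\<^bsub>S\<^esub>)"


definition coupled_of :: "'a residuated \<Rightarrow> 'a coupled"
  where "coupled_of L =
   (\<lparr>carrier = carrier L, mult = mult L, one = \<one>\<^bsub>L\<^esub>, zero = rzero L, add = rjoin L\<rparr>,
    \<lparr>carrier = carrier L, mult = rplus L, one = rzero L, zero = \<one>\<^bsub>L\<^esub>, add = rmeet L\<rparr>,
    rneg L)"

fun residuated_of :: "'a coupled \<Rightarrow> 'a residuated"
  where "residuated_of (S, T, \<alpha>) =
    \<lparr>carrier = carrier S, mult = mult S, one = \<one>\<^bsub>S\<^esub>,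
     rjoin = add S, rmeet = add T,
     rimp = (\<lambda>x\<in>carrier S. \<lambda>y\<in>carrier S. \<alpha> x \<otimes>\<^bsub>T\<^esub> y),
     rzero = \<zero>\<^bsub>S\<^esub>\<rparr>"

text \<open>Both constructions are well defined.\<close>

lemma general_coupled_semiring_coupled_of:
  assumes "residuated_lattice L" "double_negation_law L"
  shows "general_coupled_semiring (coupled_of L)"
proof -
  interpret residuated_lattice L by fact
  let ?A = "carrier L" and ?n = "rneg L" and ?z = "rzero L" and ?p = "rplus L"
  note [simp] = zero_closed
  have jc[simp]: "x \<curlyvee>\<^bsub>L\<^esub> y \<in> ?A" and mc[simp]: "x \<curlywedge>\<^bsub>L\<^esub> y \<in> ?A"
    and ic[simp]: "x \<leadsto>\<^bsub>L\<^esub> y \<in> ?A" if "x \<in> ?A" "y \<in> ?A" for x y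
    using lattice imp_op that by (auto simp: lattice_ops_def binary_op_def)
  have jcomm: "x \<curlyvee>\<^bsub>L\<^esub> y = y \<curlyvee>\<^bsub>L\<^esub> x" and mcomm: "x \<curlywedge>\<^bsub>L\<^esub> y = y \<curlywedge>\<^bsub>L\<^esub> x"
    and abs1: "x \<curlyvee>\<^bsub>L\<^esub> (x \<curlywedge>\<^bsub>L\<^esub> y) = x" and abs2: "x \<curlywedge>\<^bsub>L\<^esub> (x \<curlyvee>\<^bsub>L\<^esub> y) = x"
    if "x \<in> ?A" "y \<in> ?A" for x y
    using lattice that by (auto simp: lattice_ops_def)
  have jassoc: "(x \<curlyvee>\<^bsub>L\<^esub> y) \<curlyvee>\<^bsub>L\<^esub> z = x \<curlyvee>\<^bsub>L\<^esub> (y \<curlyvee>\<^bsub>L\<^esub> z)"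
    and massoc: "(x \<curlywedge>\<^bsub>L\<^esub> y) \<curlywedge>\<^bsub>L\<^esub> z = x \<curlywedge>\<^bsub>L\<^esub> (y \<curlywedge>\<^bsub>L\<^esub> z)"
    if "x \<in> ?A" "y \<in> ?A" "z \<in> ?A" for x y z
    using lattice that by (auto simp: lattice_ops_def)
  have idem: "x \<curlyvee>\<^bsub>L\<^esub> x = x" if "x \<in> ?A" for x
    using abs1[of x "x \<curlyvee>\<^bsub>L\<^esub> x"] abs2[of x x] that by simp
  have refl: "x \<preceq>\<^bsub>L\<^esub> x" if "x \<in> ?A" for x
    using idem that by (simp add: induced_le_def)
  have anti: "x = y" if "x \<preceq>\<^bsub>L\<^esub> y" "y \<preceq>\<^bsub>L\<^esub> x" "x \<in> ?A" "y \<in> ?A" for x y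
    using that jcomm[of x y] by (simp add: induced_le_def)
  have trans: "x \<preceq>\<^bsub>L\<^esub> z" if "x \<preceq>\<^bsub>L\<^esub> y" "y \<preceq>\<^bsub>L\<^esub> z" "x \<in> ?A" "y \<in> ?A" "z \<in> ?A" for x y z
    using that jassoc[of x y z] by (simp add: induced_le_def)
  have ub1: "x \<preceq>\<^bsub>L\<^esub> x \<curlyvee>\<^bsub>L\<^esub> y" and ub2: "y \<preceq>\<^bsub>L\<^esub> x \<curlyvee>\<^bsub>L\<^esub> y" if "x \<in> ?A" "y \<in> ?A" for x y
    using that jassoc[of x x y] jassoc[of y y x] idem jcomm by (simp_all add: induced_le_def)
  have lub: "x \<curlyvee>\<^bsub>L\<^esub> y \<preceq>\<^bsub>L\<^esub> z" if "x \<preceq>\<^bsub>L\<^esub> z" "y \<preceq>\<^bsub>L\<^esub> z" "x \<in> ?A" "y \<in> ?A" "z \<in> ?A" for x y z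
    using that jassoc[of x y z] by (simp add: induced_le_def)
  have le_meet: "x \<preceq>\<^bsub>L\<^esub> y \<longleftrightarrow> x \<curlywedge>\<^bsub>L\<^esub> y = x" if "x \<in> ?A" "y \<in> ?A" for x y
    using that abs1[of y x] abs2[of x y] jcomm[of x y] mcomm[of x y]
      jcomm[of "y \<curlywedge>\<^bsub>L\<^esub> x" y] by (auto simp: induced_le_def)
  have glb1: "x \<curlywedge>\<^bsub>L\<^esub> y \<preceq>\<^bsub>L\<^esub> x" and glb2: "x \<curlywedge>\<^bsub>L\<^esub> y \<preceq>\<^bsub>L\<^esub> y" if "x \<in> ?A" "y \<in> ?A" for x y
    using that abs1[of x y] abs1[of y x] jcomm[of "x \<curlywedge>\<^bsub>L\<^esub> y"] mcomm[of x y]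
    by (simp_all add: induced_le_def)
  have glb: "z \<preceq>\<^bsub>L\<^esub> x \<curlywedge>\<^bsub>L\<^esub> y" if "z \<preceq>\<^bsub>L\<^esub> x" "z \<preceq>\<^bsub>L\<^esub> y" "x \<in> ?A" "y \<in> ?A" "z \<in> ?A" for x y z
    using that massoc[of z x y] by (simp add: le_meet)
  have nd: "?n x = x \<leadsto>\<^bsub>L\<^esub> ?z" if "x \<in> ?A" for x
    using that by (simp add: rneg_def)
  have nc[simp]: "?n x \<in> ?A" if "x \<in> ?A" for x
    using that by (simp add: nd)
  have nn[simp]: "?n (?n x) = x" if "x \<in> ?A" for x
    using assms(2) that by (auto simp: double_negation_law_def)
  have pd: "?p x y = ?n (?n x \<otimes>\<^bsub>L\<^esub> ?n y)" if "x \<in> ?A" "y \<in> ?A" for x y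
    using that by (simp add: rplus_def)
  have le_n: "x \<preceq>\<^bsub>L\<^esub> ?n y \<longleftrightarrow> x \<otimes>\<^bsub>L\<^esub> y \<preceq>\<^bsub>L\<^esub> ?z" if "x \<in> ?A" "y \<in> ?A" for x y
    using that by (simp add: nd adjoint)
  have galois: "x \<preceq>\<^bsub>L\<^esub> ?n y \<longleftrightarrow> y \<preceq>\<^bsub>L\<^esub> ?n x" if "x \<in> ?A" "y \<in> ?A" for x y
    using that by (simp add: le_n m_comm)
  have n_anti: "?n y \<preceq>\<^bsub>L\<^esub> ?n x" if "x \<preceq>\<^bsub>L\<^esub> y" "x \<in> ?A" "y \<in> ?A" for x y
    using that galois[of "?n y" x] by simp
  have n_join: "?n (x \<curlyvee>\<^bsub>L\<^esub> y) = ?n x \<curlywedge>\<^bsub>L\<^esub> ?n y" if "x \<in> ?A" "y \<in> ?A" for x y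
  proof (rule anti)
    show "?n (x \<curlyvee>\<^bsub>L\<^esub> y) \<preceq>\<^bsub>L\<^esub> ?n x \<curlywedge>\<^bsub>L\<^esub> ?n y"
      using that by (intro glb n_anti ub1 ub2) auto
    have "x \<curlyvee>\<^bsub>L\<^esub> y \<preceq>\<^bsub>L\<^esub> ?n (?n x \<curlywedge>\<^bsub>L\<^esub> ?n y)"
      using that glb1[of "?n x" "?n y"] glb2[of "?n x" "?n y"]
      by (intro lub) (auto simp: galois)
    then show "?n x \<curlywedge>\<^bsub>L\<^esub> ?n y \<preceq>\<^bsub>L\<^esub> ?n (x \<curlyvee>\<^bsub>L\<^esub> y)"
      using that by (simp add: galois[of _ "x \<curlyvee>\<^bsub>L\<^esub> y"])
  qed (use that in auto)
  have n_one: "?n \<one>\<^bsub>L\<^esub> = ?z"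
    using le_n[of "?n \<one>\<^bsub>L\<^esub>" "\<one>\<^bsub>L\<^esub>"] refl zero_least by (intro anti) auto
  have n_zero: "?n ?z = \<one>\<^bsub>L\<^esub>"
    using nn[of "\<one>\<^bsub>L\<^esub>"] n_one by simp
  have zero_l: "?z \<otimes>\<^bsub>L\<^esub> x = ?z" if "x \<in> ?A" for x
    using that zero_least[of "?n x"] zero_least le_n[of ?z x] by (intro anti) auto
  have distr: "x \<otimes>\<^bsub>L\<^esub> (y \<curlyvee>\<^bsub>L\<^esub> z) = x \<otimes>\<^bsub>L\<^esub> y \<curlyvee>\<^bsub>L\<^esub> x \<otimes>\<^bsub>L\<^esub> z" (is "?l = ?r")
    if xyz: "x \<in> ?A" "y \<in> ?A" "z \<in> ?A" for x y z
  proof (rule anti)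
    have adj: "u \<otimes>\<^bsub>L\<^esub> v \<preceq>\<^bsub>L\<^esub> w \<longleftrightarrow> v \<preceq>\<^bsub>L\<^esub> u \<leadsto>\<^bsub>L\<^esub> w" if "u \<in> ?A" "v \<in> ?A" "w \<in> ?A" for u v w
      using that adjoint[of v u w] by (simp add: m_comm)
    have "y \<preceq>\<^bsub>L\<^esub> x \<leadsto>\<^bsub>L\<^esub> ?r" "z \<preceq>\<^bsub>L\<^esub> x \<leadsto>\<^bsub>L\<^esub> ?r"
      using xyz ub1[of "x \<otimes>\<^bsub>L\<^esub> y" "x \<otimes>\<^bsub>L\<^esub> z"] ub2[of "x \<otimes>\<^bsub>L\<^esub> y" "x \<otimes>\<^bsub>L\<^esub> z"]
      by (simp_all flip: adj)
    then show "?l \<preceq>\<^bsub>L\<^esub> ?r" using xyz by (simp add: adj lub)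
    have "y \<preceq>\<^bsub>L\<^esub> x \<leadsto>\<^bsub>L\<^esub> ?l" "z \<preceq>\<^bsub>L\<^esub> x \<leadsto>\<^bsub>L\<^esub> ?l"
      using xyz adj[of x "y \<curlyvee>\<^bsub>L\<^esub> z" ?l] refl[of ?l]
        trans[OF ub1[of y z]] trans[OF ub2[of y z]] by simp_all
    then show "?r \<preceq>\<^bsub>L\<^esub> ?l" using xyz by (intro lub) (simp_all add: adj)
  qed (use xyz in auto)
  have n_inj: "x = y" if "?n x = ?n y" "x \<in> ?A" "y \<in> ?A" for x y
    using that nn by metis
  have n_p: "?n (?p x y) = ?n x \<otimes>\<^bsub>L\<^esub> ?n y" and pc[simp]: "?p x y \<in> ?A"
    if "x \<in> ?A" "y \<in> ?A" for x y
    using that by (simp_all add: pd)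
  have n_meet: "?n (x \<curlywedge>\<^bsub>L\<^esub> y) = ?n x \<curlyvee>\<^bsub>L\<^esub> ?n y" if "x \<in> ?A" "y \<in> ?A" for x y
    using that n_join[of "?n x" "?n y"] nn[of "?n x \<curlyvee>\<^bsub>L\<^esub> ?n y"] by simp
  have pcomm: "?p x y = ?p y x" if "x \<in> ?A" "y \<in> ?A" for x y
    using that by (simp add: pd m_comm)
  have passoc: "?p (?p x y) z = ?p x (?p y z)" if "x \<in> ?A" "y \<in> ?A" "z \<in> ?A" for x y z
    by (rule n_inj) (use that in \<open>simp_all add: n_p m_assoc\<close>)
  have pzero: "?p ?z x = x" if "x \<in> ?A" for x
    using that by (simp add: pd n_zero)
  have pone: "?p \<one>\<^bsub>L\<^esub> x = \<one>\<^bsub>L\<^esub>" if "x \<in> ?A" for x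
    using that by (simp add: pd n_one n_zero zero_l)
  have pdistr: "?p x (y \<curlywedge>\<^bsub>L\<^esub> z) = ?p x y \<curlywedge>\<^bsub>L\<^esub> ?p x z" if "x \<in> ?A" "y \<in> ?A" "z \<in> ?A" for x y z
    by (rule n_inj) (use that in \<open>simp_all add: n_p n_meet distr\<close>)
  have jzero: "?z \<curlyvee>\<^bsub>L\<^esub> x = x" if "x \<in> ?A" for x
    using that zero_least by (simp add: induced_le_def)
  have mone: "\<one>\<^bsub>L\<^esub> \<curlywedge>\<^bsub>L\<^esub> x = x" if "x \<in> ?A" for x
    using that one_greatest[of x] mcomm[of x "\<one>\<^bsub>L\<^esub>"] by (simp add: le_meet)
  have p_op: "binary_op ?A ?p"
    by (auto simp: binary_op_def rplus_def)
  have le_iff: "x \<preceq>\<^bsub>L\<^esub> y \<longleftrightarrow> ?p (?n x) y = \<one>\<^bsub>L\<^esub>" if "x \<in> ?A" "y \<in> ?A" for x y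
  proof -
    have "?p (?n x) y = \<one>\<^bsub>L\<^esub> \<longleftrightarrow> x \<otimes>\<^bsub>L\<^esub> ?n y = ?z"
      using that n_inj[of "?p (?n x) y" "\<one>\<^bsub>L\<^esub>"] n_p[of "?n x" y] n_one by auto
    also have "\<dots> \<longleftrightarrow> x \<otimes>\<^bsub>L\<^esub> ?n y \<preceq>\<^bsub>L\<^esub> ?z"
      using that refl zero_least anti by auto
    also have "\<dots> \<longleftrightarrow> x \<preceq>\<^bsub>L\<^esub> y"
      using that le_n[of x "?n y"] by simp
    finally show ?thesis by simp
  qed
  let ?S = "\<lparr>carrier = ?A, mult = mult L, one = \<one>\<^bsub>L\<^esub>, zero = ?z, add = rjoin L\<rparr>"
  let ?T = "\<lparr>carrier = ?A, mult = ?p, one = ?z, zero = \<one>\<^bsub>L\<^esub>, add = rmeet L\<rparr>"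
  have distr2: "(y \<curlyvee>\<^bsub>L\<^esub> z) \<otimes>\<^bsub>L\<^esub> x = y \<otimes>\<^bsub>L\<^esub> x \<curlyvee>\<^bsub>L\<^esub> z \<otimes>\<^bsub>L\<^esub> x"
    and pdistr2: "?p (y \<curlywedge>\<^bsub>L\<^esub> z) x = ?p y x \<curlywedge>\<^bsub>L\<^esub> ?p z x"
    if "x \<in> ?A" "y \<in> ?A" "z \<in> ?A" for x y z
    using that distr pdistr by (simp_all add: m_comm[of _ x] pcomm[of _ x])
  have zero_r: "x \<otimes>\<^bsub>L\<^esub> ?z = ?z" and pone2: "?p x \<one>\<^bsub>L\<^esub> = \<one>\<^bsub>L\<^esub>" if "x \<in> ?A" for x
    using that zero_l pone m_comm[of x ?z] pcomm[of x "\<one>\<^bsub>L\<^esub>"] by simp_all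
  have ops: "binary_op ?A (rjoin L)" "binary_op ?A (rmeet L)"
    using lattice by (auto simp: lattice_ops_def)
  have S: "commutative_semiring ?S"
    unfolding commutative_semiring_def
  proof (intro conjI)
    show "comm_monoid ?S"
      by (rule comm_monoidI) (auto simp: m_assoc intro: m_comm)
    then have "monoid ?S" by (rule comm_monoid.axioms)
    moreover have "abelian_monoid ?S"
      by (rule abelian_monoidI) (auto simp: jassoc jzero intro: jcomm)
    ultimately show "semiring ?S"
      by (intro semiring.intro semiring_axioms.intro)
         (auto simp: distr distr2 zero_l zero_r)
  qed (use ops mult_op in auto)
  have T: "commutative_semiring ?T"
    unfolding commutative_semiring_def
  proof (intro conjI)
    show "comm_monoid ?T"
      by (rule comm_monoidI) (auto simp: passoc pzero intro: pcomm)
    then have "monoid ?T" by (rule comm_monoid.axioms)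
    moreover have "abelian_monoid ?T"
      by (rule abelian_monoidI) (auto simp: massoc mone intro: mcomm)
    ultimately show "semiring ?T"
      by (intro semiring.intro semiring_axioms.intro)
         (auto simp: pdistr pdistr2 pone pone2)
  qed (use ops p_op in auto)
  have "bij_betw ?n ?A ?A"
    by (rule bij_betwI[of _ _ _ ?n]) auto
  then have iso: "?n \<in> semiring_iso ?S ?T"
    by (auto simp: semiring_iso_def ring_iso_def ring_hom_def n_join n_one n_zero pd)
  show ?thesis
    using S T iso lattice le_iff
    by (simp add: coupled_of_def) (simp add: rneg_def)
qed

lemma residuated_lattice_residuated_of:
  assumes "general_coupled_semiring C"
  shows "residuated_lattice (residuated_of C)"
    and "double_negation_law (residuated_of C)"
proof -
  obtain S T \<alpha> where C: "C = (S, T, \<alpha>)" by (cases C) auto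
  let ?A = "carrier S"
  have car: "carrier T = ?A" "\<zero>\<^bsub>T\<^esub> = \<one>\<^bsub>S\<^esub>" "\<one>\<^bsub>T\<^esub> = \<zero>\<^bsub>S\<^esub>"
    and S: "semiring S" "comm_monoid S" "binary_op ?A (mult S)"
    and T: "semiring T" "comm_monoid T"
    and lat: "lattice_ops ?A (add S) (add T)"
    and iso: "\<alpha> \<in> semiring_iso S T"
    and inv: "\<And>x. x \<in> ?A \<Longrightarrow> \<alpha> (\<alpha> x) = x"
    and le: "\<And>x y. \<lbrakk>x \<in> ?A; y \<in> ?A\<rbrakk> \<Longrightarrow> induced_le (add S) x y \<longleftrightarrow> \<alpha> x \<otimes>\<^bsub>T\<^esub> y = \<one>\<^bsub>S\<^esub>"
    using assms by (auto simp: C commutative_semiring_def)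
  interpret S: semiring S by fact
  interpret T: semiring T by fact
  interpret SM: comm_monoid S by fact
  interpret TM: comm_monoid T by fact
  have ac[simp]: "\<alpha> x \<in> ?A" if "x \<in> ?A" for x
    using iso that car by (auto simp: semiring_iso_def ring_iso_def ring_hom_def)
  have am: "\<alpha> (x \<otimes>\<^bsub>S\<^esub> y) = \<alpha> x \<otimes>\<^bsub>T\<^esub> \<alpha> y" if "x \<in> ?A" "y \<in> ?A" for x y
    using iso that by (auto simp: semiring_iso_def ring_iso_def ring_hom_def)
  have tc[simp]: "x \<otimes>\<^bsub>T\<^esub> y \<in> ?A" if "x \<in> ?A" "y \<in> ?A" for x y
    using T.m_closed that by (simp add: car)
  have t0: "x \<otimes>\<^bsub>T\<^esub> \<zero>\<^bsub>S\<^esub> = x" if "x \<in> ?A" for x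
    using T.r_one[of x] that by (simp add: car)
  have tassoc: "(x \<otimes>\<^bsub>T\<^esub> y) \<otimes>\<^bsub>T\<^esub> z = x \<otimes>\<^bsub>T\<^esub> (y \<otimes>\<^bsub>T\<^esub> z)" if "x \<in> ?A" "y \<in> ?A" "z \<in> ?A" for x y z
    using T.m_assoc that by (simp add: car)
  have top: "induced_le (add S) x \<one>\<^bsub>S\<^esub>" if "x \<in> ?A" for x
    using that le[of x "\<one>\<^bsub>S\<^esub>"] T.r_null[of "\<alpha> x"] by (simp add: car)
  show "residuated_lattice (residuated_of C)"
  proof (intro residuated_lattice.intro residuated_lattice_axioms.intro)
    show "comm_monoid (residuated_of C)"
      by (rule comm_monoidI) (auto simp: C S.m_assoc intro: SM.m_comm)
  qed (use S(3) lat top le in \<open>auto simp: C binary_op_def induced_le_def[of _ "\<zero>\<^bsub>S\<^esub>"] am tassoc\<close>)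
  show "double_negation_law (residuated_of C)"
    by (auto simp: C double_negation_law_def rneg_def t0 inv)
qed

end

theory Submission
  imports Defs
begin

text \<open>
  Both constructions leave every component of the residuated lattice untouched except the residuum,
  which is replaced by \<open>\<not> x \<oplus> y\<close>. So the claim is the identity \<open>\<not> x \<oplus> y = x \<rightarrow> y\<close>. It is
  a consequence of the currying law \<open>x \<otimes> y \<rightarrow> z = x \<rightarrow> (y \<rightarrow> z)\<close> (\<open>imp_mult\<close>), which holds in every
  residuated lattice: cancelling double negations before and after currying gives
  \<open>\<not> x \<oplus> y = \<not> (\<not> \<not> x \<otimes> \<not> y) = (x \<otimes> \<not> y) \<rightarrow> 0 = x \<rightarrow> \<not> \<not> y = x \<rightarrow> y\<close>.

  This settles the residuum on the carrier. Outside the carrier the recovered residuum is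
  \<open>undefined\<close>, as is the original one, so the two are equal as functions.
\<close>

lemma (in residuated_lattice) imp_closed:
  "\<lbrakk>x \<in> carrier L; y \<in> carrier L\<rbrakk> \<Longrightarrow> x \<leadsto> y \<in> carrier L"
  using imp_op by (auto simp: binary_op_def)

lemma lattice_ops_join_idem:
  assumes "lattice_ops A j m" "x \<in> A"
  shows "j x x = x"
proof -
  have "j x x \<in> A" "j x (m x (j x x)) = x" "m x (j x x) = x"
    using assms unfolding lattice_ops_def binary_op_def by (blast dest: PiE_mem)+
  then show ?thesis by simp
qed

text \<open>The order form of the Yoneda lemma, by which equations between residua are derived from
  adjointness.\<close>

lemma (in residuated_lattice) eq_if_same_lower_bounds:
  assumes "a \<in> carrier L" "b \<in> carrier L"
    and "\<And>u. u \<in> carrier L \<Longrightarrow> u \<preceq> a \<longleftrightarrow> u \<preceq> b"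
  shows "a = b"
proof -
  have "a \<preceq> a" "b \<preceq> b"
    using lattice_ops_join_idem[OF lattice] assms(1,2) by (simp_all add: induced_le_def)
  then have "a \<preceq> b" "b \<preceq> a"
    using assms by auto
  moreover have "a \<curlyvee> b = b \<curlyvee> a"
    using lattice assms(1,2) by (auto simp: lattice_ops_def)
  ultimately show ?thesis
    by (simp add: induced_le_def)
qed

text \<open>By adjointness \<open>u\<close> lies below either side iff \<open>u \<otimes> x \<otimes> y\<close> lies below \<open>z\<close>.\<close>

lemma (in residuated_lattice) imp_mult:
  assumes "x \<in> carrier L" "y \<in> carrier L" "z \<in> carrier L"
  shows "x \<otimes> y \<leadsto> z = x \<leadsto> y \<leadsto> z"
  by (rule eq_if_same_lower_bounds) (use assms in \<open>simp_all add: imp_closed adjoint m_assoc\<close>)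

lemma (in residuated_lattice) rplus_rneg_eq_imp:
  assumes "double_negation_law L" "x \<in> carrier L" "y \<in> carrier L"
  shows "rplus L (rneg L x) y = x \<leadsto> y"
proof -
  have neg: "rneg L u = u \<leadsto> rzero L" "rneg L u \<in> carrier L" "rneg L (rneg L u) = u"
    if "u \<in> carrier L" for u
    using assms(1) that imp_closed zero_closed
    by (auto simp: rneg_def double_negation_law_def)
  have "rplus L (rneg L x) y = rneg L (x \<otimes> rneg L y)"
    using assms neg by (simp add: rplus_def)
  also have "\<dots> = x \<leadsto> rneg L y \<leadsto> rzero L"
    using assms neg(2) by (simp add: neg(1)[of "x \<otimes> rneg L y"] imp_mult zero_closed)
  also have "\<dots> = x \<leadsto> y"
    using assms neg(1)[of "rneg L y"] neg(2,3) by simp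
  finally show ?thesis .
qed

theorem theorem12:
  fixes L :: "'a residuated"
  assumes "residuated_lattice L"
    and "double_negation_law L"
  shows "residuated_of (coupled_of L) = L"
proof -
  interpret residuated_lattice L by fact
  have "(\<lambda>x\<in>carrier L. \<lambda>y\<in>carrier L. rplus L (rneg L x) y)
      = (\<lambda>x\<in>carrier L. \<lambda>y\<in>carrier L. rimp L x y)"
    using assms(2) by (intro restrict_ext) (simp add: rplus_rneg_eq_imp)
  also have "\<dots> = rimp L"
  proof (rule extensionalityI[of _ "carrier L"])
    show "rimp L \<in> extensional (carrier L)"
      using imp_op by (simp add: binary_op_def PiE_def)
    show "(\<lambda>x\<in>carrier L. \<lambda>y\<in>carrier L. rimp L x y) x = rimp L x" if "x \<in> carrier L" for x
      using imp_op that by (simp add: binary_op_def PiE_def Pi_iff extensional_restrict)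
  qed simp
  finally show ?thesis
    by (simp add: coupled_of_def)
qed

end
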